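(* For all given $0<\epsilon_1\le 1$ and $L\ge 1$ there exist $d_0$ and $K_0$ such that the following holds for any $d\ge d_0$, $K\ge K_0$ and $n\in\mathbb{N}$ with $\log^{100} n\le d\le n/K$. If $H$ is an $n$-vertex $(\epsilon_1,d/30)$-expander with $d/10\le\delta(H)\le\Delta(H)\le Ld$, then $V(H)$ contains a set $Z$ of size $200d$ such that, for every subset $U\subseteq Z$ of size $100d$, there exists a cycle $C_U$ in $H$ such that $V(C_U)\cap Z$ is a subset of $U$ of size at least $98d$.
   Context: Graphs are finite and simple; $\delta(H)$ and $\Delta(H)$ are the minimum and maximum degree. $\log$ is the natural logarithm and $\log^k x=(\log x)^k$. For a vertex set $X$ in a graph $G$, the external neighbourhood $\Gamma_G(X)$ is the set of vertices outside $X$ having at least one neighbour in $X$. For $\epsilon_1>0$, $t>0$ define $\epsilon(x)=\epsilon(x,\epsilon_1,t):=0$ if $x<t/5$ and $\epsilon(x):=\epsilon_1/\log^2(15x/t)$ if $x\ge t/5$. A graph $G$ is an $(\epsilon_1,t)$-expander if every $X\subseteq V(G)$ with $t/2\le|X|\le|V(G)|/2$ satisfies $|\Gamma_G(X)|\ge\epsilon(|X|)\cdot|X|$. Convention: floors and ceilings are omitted, i.e. large quantities such as $200d$ and $100d$ are treated as integers. *)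

theory Defs
  imports Complex_Main "Graph_Theory.Pair_Digraph"
begin

text \<open>
  A finite simple graph is a \<^locale>\<open>pair_graph\<close>: a finite vertex set with a finite, symmetric,
  irreflexive set of ordered pairs, where an undirected edge \<open>uv\<close> is represented by the two
  arcs \<open>(u,v)\<close> and \<open>(v,u)\<close>. The degree of a vertex is therefore its
  \<^const>\<open>out_degree\<close>.
\<close>

definition min_degree :: "'a pair_pre_digraph \<Rightarrow> nat" where
  "min_degree G = Min (out_degree (with_proj G) ` pverts G)"

definition max_degree :: "'a pair_pre_digraph \<Rightarrow> nat" where
  "max_degree G = Max (out_degree (with_proj G) ` pverts G)"

definition ext_nbhd :: "'a pair_pre_digraph \<Rightarrow> 'a set \<Rightarrow> 'a set" where
  "ext_nbhd G X = {v \<in> pverts G - X. \<exists>x\<in>X. (x, v) \<in> parcs G}"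

definition expansion :: "real \<Rightarrow> real \<Rightarrow> real \<Rightarrow> real" where
  "expansion \<epsilon>\<^sub>1 t x = (if x < t / 5 then 0 else \<epsilon>\<^sub>1 / (ln (15 * x / t))^2)"

definition expander :: "real \<Rightarrow> real \<Rightarrow> 'a pair_pre_digraph \<Rightarrow> bool" where
  "expander \<epsilon>\<^sub>1 t G \<longleftrightarrow>
     (\<forall>X \<subseteq> pverts G.
        t / 2 \<le> real (card X) \<and> real (card X) \<le> real (card (pverts G)) / 2 \<longrightarrow>
        real (card (ext_nbhd G X)) \<ge> expansion \<epsilon>\<^sub>1 t (real (card X)) * real (card X))"

text \<open>
  The library's \<^const>\<open>pre_digraph.cycle\<close> is a nonempty closed walk, given by its list of arcs,
  without repeated vertices. It admits traversing an edge back and forth, i.e. \<open>[(u,v), (v,u)]\<close>;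
  the length bound excludes exactly this case, leaving the cycles of the undirected graph.
\<close>

definition graph_cycle :: "'a pair_pre_digraph \<Rightarrow> ('a \<times> 'a) awalk \<Rightarrow> bool" where
  "graph_cycle G C \<longleftrightarrow> pre_digraph.cycle (with_proj G) C \<and> 3 \<le> length C"

text \<open>Every vertex of a cycle is the tail of one of its arcs.\<close>

definition cycle_verts :: "('a \<times> 'a) awalk \<Rightarrow> 'a set" where
  "cycle_verts C = fst ` set C"

end

theory Submission
  imports Defs "HOL-Analysis.Convex" "HOL-Real_Asymp.Real_Asymp"
begin

text \<open>
  Choose \<open>Z\<close> greedily so that the sum over all vertices \<open>v\<close> of the squared number of neighbours of \<open>v\<close>
  in \<open>Z\<close> stays small. By Cauchy--Schwarz every \<open>A \<subseteq> Z\<close> with at least \<open>d / 4\<close> elements then has a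
  neighbourhood of size at least a constant times \<open>min (d\<^sup>2) n\<close>, which exceeds \<open>d\<close> times any fixed power
  of \<open>ln (n / d)\<close>. Hence, after deleting \<open>Z\<close> and any \<open>O (d * ln (n / d) ^ 3)\<close> further vertices,
  expansion makes such neighbourhoods grow beyond \<open>n / 2\<close> within \<open>O (ln (n / d) ^ 3)\<close> steps, so any two such
  sets \<open>A\<close>, \<open>B\<close> are linked by a short path avoiding the deleted vertices. Only the linking of
  large sets, not of prescribed vertices, is available, and a depth-first search that takes such links as
  its edges turns this into a path through almost all of \<open>U\<close>.
\<close>

section \<open>Links between vertices and the depth-first search\<close>

text \<open>Only the inner vertices must lie in \<open>I\<close> and only they count towards
  \<open>m\<close>, so the ends may be in \<open>Z\<close> while \<open>I\<close> avoids
  \<open>Z\<close>. A single edge is the case \<open>p = []\<close>.\<close>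

definition joined :: "('a \<Rightarrow> 'a \<Rightarrow> bool) \<Rightarrow> 'a set \<Rightarrow> nat \<Rightarrow> 'a \<Rightarrow> 'a \<Rightarrow> bool" where
  "joined E I m a b \<longleftrightarrow>
     (\<exists>p. set p \<subseteq> I \<and> distinct p \<and> length p \<le> m \<and> successively E (a # p @ [b]))"

lemma joined_mono: "joined E I m a b \<Longrightarrow> I \<subseteq> J \<Longrightarrow> joined E J m a b"
  unfolding joined_def by blast

text \<open>A repeated inner vertex allows a shortcut from its first to its later occurrence; this
  shortens the walk and keeps its ends.\<close>

lemma joined_if_walk:
  assumes "successively E (a # p @ [b])" "set p \<subseteq> I" "length p \<le> m"
  shows "joined E I m a b"
  using assms
proof (induction p rule: length_induct)
  case (1 p)
  show ?case
  proof (cases "distinct p")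
    case True
    then show ?thesis using 1 unfolding joined_def by blast
  next
    case False
    then obtain xs ys zs z where p: "p = xs @ [z] @ ys @ [z] @ zs"
      using not_distinct_decomp by blast
    have "successively E (a # (xs @ z # zs) @ [b])"
      using 1(2) unfolding p by (auto simp: successively_append_iff successively_Cons hd_append)
    moreover have "set (xs @ z # zs) \<subseteq> I" "length (xs @ z # zs) < length p"
      using 1(3) p by auto
    ultimately show ?thesis using "1.IH" "1.prems"(3) by (meson less_imp_le order_trans)
  qed
qed

text \<open>
  State of the search: the current path \<open>vs\<close>, whose end \<open>hd vs\<close> is extended, the unvisited vertices
  \<open>S\<close>, the vertices \<open>D\<close> from which the search has retreated, and the set \<open>W\<close> of connecting vertices
  used so far, including those on abandoned pieces of path. Since \<open>W\<close> only grows and \<open>S\<close> only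
  shrinks, a vertex without a link to \<open>S\<close> keeps this property, and every step lowers
  \<open>card S - card D\<close> by exactly one.
\<close>

lemma depth_first_path:
  assumes "finite U" "U \<subseteq> Z" "finite I" "I \<inter> Z = {}" "j \<le> card U"
  shows "\<exists>vs S D W. distinct vs \<and> successively E vs \<and> (vs \<noteq> [] \<longrightarrow> hd vs \<in> Z) \<and>
    S \<union> D \<union> (set vs \<inter> Z) = U \<and> S \<inter> D = {} \<and> S \<inter> set vs = {} \<and> D \<inter> set vs = {} \<and>
    set vs - Z \<subseteq> W \<and> W \<subseteq> I \<and> card W \<le> m * (card U - card S) \<and>
    (\<forall>x\<in>S. \<forall>y\<in>D. \<not> joined E (I - W) m x y) \<and> card S + j = card D + card U"
  using assms(5)
proof (induction j)
  case 0
  show ?case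
    by (rule exI[of _ "[]"], rule exI[of _ U], rule exI[of _ "{}"], rule exI[of _ "{}"]) auto
next
  case (Suc j)
  then obtain vs S D W where
    vs: "distinct vs" "successively E vs" "vs \<noteq> [] \<Longrightarrow> hd vs \<in> Z" and
    part: "S \<union> D \<union> (set vs \<inter> Z) = U" "S \<inter> D = {}" "S \<inter> set vs = {}" "D \<inter> set vs = {}" and
    W: "set vs - Z \<subseteq> W" "W \<subseteq> I" "card W \<le> m * (card U - card S)" and
    nj: "\<And>x y. x \<in> S \<Longrightarrow> y \<in> D \<Longrightarrow> \<not> joined E (I - W) m x y" and
    c: "card S + j = card D + card U" by (metis Suc_leD)
  have fin: "finite S" "finite D" using part(1) \<open>finite U\<close> by (auto intro: finite_subset)
  have SU: "S \<subseteq> U" using part(1) by blast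
  have cSU: "card S \<le> card U" using SU \<open>finite U\<close> by (rule card_mono[rotated])
  have S0: "S \<noteq> {}" using c Suc.prems by auto
  then have cS0: "card S > 0" using fin by (simp add: card_gt_0_iff)
  show ?case
  proof (cases "\<exists>u\<in>S. vs = [] \<or> joined E (I - W) m u (hd vs)")
    case False
    then obtain v rest where v: "vs = v # rest" using S0 by (cases vs) auto
    \<comment> \<open>The link behind \<open>v\<close> is abandoned together with \<open>v\<close>,
      so that the path again ends in a vertex of \<open>Z\<close>; its vertices remain in
      \<open>W\<close>.\<close>
    define ws where "ws = dropWhile (\<lambda>x. x \<notin> Z) rest"
    have rest: "rest = takeWhile (\<lambda>x. x \<notin> Z) rest @ ws" unfolding ws_def by simp
    have tZ: "set (takeWhile (\<lambda>x. x \<notin> Z) rest) \<inter> Z = {}" by (auto dest: set_takeWhileD)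
    have wsZ: "set ws \<inter> Z = set rest \<inter> Z"
    proof -
      have "set rest = set (takeWhile (\<lambda>x. x \<notin> Z) rest) \<union> set ws" by (subst rest) simp
      then show ?thesis using tZ by auto
    qed
    have wsub: "set ws \<subseteq> set rest" unfolding ws_def by (meson set_dropWhileD subsetI)
    have vZ: "v \<in> Z" using vs(3) v by simp
    show ?thesis
    proof (rule exI[of _ ws], rule exI[of _ S], rule exI[of _ "insert v D"], rule exI[of _ W], intro conjI)
      show "distinct ws" using vs(1) v by (simp add: ws_def)
      show "successively E ws" using vs(2) v rest
        by (metis successively_Cons successively_append_iff successively.simps(1))
      show "ws \<noteq> [] \<longrightarrow> hd ws \<in> Z" unfolding ws_def using hd_dropWhile by metis
      show "S \<union> insert v D \<union> set ws \<inter> Z = U" using part(1) v vZ wsZ by auto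
      show "S \<inter> insert v D = {}" using part v by auto
      show "S \<inter> set ws = {}" using part v wsub by auto
      show "insert v D \<inter> set ws = {}" using part v wsub vs(1) by auto
      show "set ws - Z \<subseteq> W" using W(1) v wsub by auto
      show "\<forall>x\<in>S. \<forall>y\<in>insert v D. \<not> joined E (I - W) m x y" using nj False v by auto
      have "v \<notin> D" using part v by auto
      then show "card S + Suc j = card (insert v D) + card U" using c fin by simp
    qed (use W in auto)
  next
    case True
    then obtain u p where u: "u \<in> S" and p: "set p \<subseteq> I - W" "distinct p" "length p \<le> m"
        "successively E (u # p @ vs)"
    proof -
      assume that: "\<And>u p. u \<in> S \<Longrightarrow> set p \<subseteq> I - W \<Longrightarrow> distinct p \<Longrightarrow> length p \<le> m \<Longrightarrow>
        successively E (u # p @ vs) \<Longrightarrow> thesis"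
      obtain u where u: "u \<in> S" "vs = [] \<or> joined E (I - W) m u (hd vs)" using True by blast
      \<comment> \<open>An empty path is restarted at any unvisited vertex, without a link.\<close>
      show thesis
      proof (cases "vs = []")
        case True
        then show thesis using that[OF u(1), of "[]"] by simp
      next
        case False
        then obtain p where "set p \<subseteq> I - W" "distinct p" "length p \<le> m"
            "successively E (u # p @ [hd vs])"
          using u(2) unfolding joined_def by blast
        then show thesis using that[OF u(1), of p] vs(2) False
          by (cases "p = []") (auto simp: successively_append_iff successively_Cons)
      qed
    qed
    have pZ: "set p \<inter> Z = {}" using p(1) assms(4) by blast
    have pvs: "set p \<inter> set vs = {}" using p(1) W(1) pZ by blast
    have uZ: "u \<in> Z" "u \<in> U" using u SU \<open>U \<subseteq> Z\<close> by auto
    show ?thesis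
    proof (rule exI[of _ "u # p @ vs"], rule exI[of _ "S - {u}"], rule exI[of _ D],
        rule exI[of _ "W \<union> set p"], intro conjI)
      show "distinct (u # p @ vs)" using vs(1) p(2) pvs u part uZ pZ by auto
      show "S - {u} \<union> D \<union> set (u # p @ vs) \<inter> Z = U" using part(1) u uZ pZ by auto
      show "(S - {u}) \<inter> set (u # p @ vs) = {}" using part SU \<open>U \<subseteq> Z\<close> pZ by auto
      show "D \<inter> set (u # p @ vs) = {}" using part u \<open>U \<subseteq> Z\<close> pZ by auto
      show "set (u # p @ vs) - Z \<subseteq> W \<union> set p" using W uZ by auto
      have "card (W \<union> set p) \<le> card W + card (set p)" by (rule card_Un_le)
      also have "\<dots> \<le> m * (card U - card S) + m"
        using W(3) p(3) card_length[of p] by linarith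
      \<comment> \<open>The one vertex that leaves \<open>S\<close> pays for the at most
        \<open>m\<close> new vertices of \<open>W\<close>.\<close>
      also have "\<dots> = m * (card U - card (S - {u}))"
      proof -
        have "card U - card (S - {u}) = Suc (card U - card S)" using u fin cS0 cSU by simp
        then show ?thesis by simp
      qed
      finally show "card (W \<union> set p) \<le> m * (card U - card (S - {u}))" .
      show "\<forall>x\<in>S - {u}. \<forall>y\<in>D. \<not> joined E (I - (W \<union> set p)) m x y"
        using nj joined_mono[of E "I - (W \<union> set p)" m _ _ "I - W"] by blast
      show "card (S - {u}) + Suc j = card D + card U" using c u fin cS0 by simp
    qed (use W p uZ part in auto)
  qed
qed

text \<open>The count of a prefix rises by at most one per element, so it takes every value up to
  the total.\<close>

lemma split_list_filter:
  assumes "k \<le> length (filter P vs)"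
  shows "\<exists>xs ys. vs = xs @ ys \<and> length (filter P xs) = k"
  using assms
proof (induction vs arbitrary: k)
  case Nil
  then show ?case by auto
next
  case (Cons v vs)
  show ?case
  proof (cases "k = 0")
    case True
    then show ?thesis by (intro exI[of _ "[]"] exI[of _ "v # vs"]) auto
  next
    case False
    have "(if P v then k - 1 else k) \<le> length (filter P vs)" using Cons.prems False by auto
    from Cons.IH[OF this] obtain xs ys where
      "vs = xs @ ys" "length (filter P xs) = (if P v then k - 1 else k)" by blast
    then show ?thesis using False by (intro exI[of _ "v # xs"] exI[of _ ys]) auto
  qed
qed

lemma card_set_Int: "distinct vs \<Longrightarrow> card (set vs \<inter> Z) = length (filter (\<lambda>x. x \<in> Z) vs)"
  by (metis Int_commute distinct_card distinct_filter inter_set_filter)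

text \<open>
  The depth-first search misses fewer than \<open>2 * s\<close> vertices of \<open>U\<close>; one more link between the
  first \<open>s\<close> and the last \<open>s\<close> vertices of \<open>Z\<close> on its path closes a cycle.
\<close>

lemma cycle_if_linked:
  assumes "finite U" "U \<subseteq> Z" "finite I" "I \<inter> Z = {}"
    and sym: "\<And>x y. E x y \<Longrightarrow> E y x"
    and link: "\<And>A B W. A \<subseteq> Z \<Longrightarrow> B \<subseteq> Z \<Longrightarrow> s \<le> card A \<Longrightarrow> s \<le> card B \<Longrightarrow> W \<subseteq> I \<Longrightarrow>
      card W \<le> m * card U \<Longrightarrow> \<exists>a\<in>A. \<exists>b\<in>B. joined E (I - W) m a b"
    and s: "4 * s \<le> card U"
  shows "\<exists>c. c \<noteq> [] \<and> distinct c \<and> successively E (c @ [hd c]) \<and> set c \<inter> Z \<subseteq> U \<and>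
    card U \<le> card (set c \<inter> Z) + 4 * s"
proof -
  obtain vs S D W where
    vs: "distinct vs" "successively E vs" and
    part: "S \<union> D \<union> (set vs \<inter> Z) = U" "S \<inter> D = {}" "S \<inter> set vs = {}" "D \<inter> set vs = {}" and
    W: "set vs - Z \<subseteq> W" "W \<subseteq> I" "card W \<le> m * (card U - card S)" and
    nj: "\<forall>x\<in>S. \<forall>y\<in>D. \<not> joined E (I - W) m x y" and
    c: "card S + card U = card D + card U"
    using depth_first_path[OF assms(1-4) order_refl, of E m]
    by - (elim exE conjE, rule that; assumption)
  have fin: "finite S" "finite D" using part(1) \<open>finite U\<close> by (auto intro: finite_subset)
  have W': "card W \<le> m * card U" using W(3) by (meson diff_le_self mult_le_mono2 order_trans)
  \<comment> \<open>At \<open>j = card U\<close> the search has \<open>card S = card D\<close>. If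
    both sets had at least \<open>s\<close> elements, \<open>link\<close> would join them outside
    \<open>W\<close>, contrary to \<open>nj\<close>.\<close>
  have "card S < s"
  proof (rule ccontr)
    assume "\<not> card S < s"
    then have "\<exists>x\<in>S. \<exists>y\<in>D. joined E (I - W) m x y"
      using c part(1) \<open>U \<subseteq> Z\<close> W(2) W' by (intro link) auto
    then show False using nj by blast
  qed
  moreover have "card U = card S + card D + card (set vs \<inter> Z)"
  proof -
    have "card (S \<union> D \<union> (set vs \<inter> Z)) = card (S \<union> D) + card (set vs \<inter> Z)"
      using part fin by (intro card_Un_disjoint) auto
    moreover have "card (S \<union> D) = card S + card D" using part fin by (intro card_Un_disjoint) auto
    ultimately show ?thesis using part(1) by simp
  qed
  ultimately have cv: "card U < card (set vs \<inter> Z) + 2 * s" using c by linarith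
  let ?P = "\<lambda>x. x \<in> Z"
  \<comment> \<open>The path contains more than \<open>2 * s\<close> vertices of \<open>Z\<close>,
    so the pieces \<open>xs\<close> and \<open>zs\<close> with the first and last \<open>s\<close>
    of them do not overlap.\<close>
  have "s \<le> length (filter ?P vs)" using cv s card_set_Int[OF vs(1), of Z] by simp
  then obtain xs us where xs: "vs = xs @ us" "length (filter ?P xs) = s"
    using split_list_filter by blast
  have lus: "length (filter ?P us) + s = card (set vs \<inter> Z)"
    using xs card_set_Int[OF vs(1), of Z] by simp
  then have "length (filter ?P us) - s \<le> length (filter ?P us)" by simp
  then obtain ys zs where us: "us = ys @ zs" "length (filter ?P ys) = length (filter ?P us) - s"
    using split_list_filter by blast
  have lzs: "length (filter ?P zs) = s" using us lus cv s by auto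
  have d: "distinct xs" "distinct ys" "distinct zs" using vs(1) xs us by auto
  have "\<exists>a\<in>set xs \<inter> Z. \<exists>b\<in>set zs \<inter> Z. joined E (I - W) m a b"
    using xs lzs d W(2) W' by (intro link) (auto simp: card_set_Int)
  then obtain a b p where ab: "a \<in> set xs" "a \<in> Z" "b \<in> set zs" "b \<in> Z" and
    p: "set p \<subseteq> I - W" "distinct p" "successively E (a # p @ [b])"
    unfolding joined_def by blast
  obtain x1 x2 where x: "xs = x1 @ a # x2" using ab split_list by fast
  obtain z1 z2 where z: "zs = z1 @ b # z2" using ab split_list by fast
  \<comment> \<open>The cycle follows the path from \<open>a\<close> to \<open>b\<close> and returns
    along the reversed link.\<close>
  define c where "c = a # x2 @ ys @ z1 @ [b] @ rev p"
  \<comment> \<open>\<open>W\<close> contains every vertex of the path outside \<open>Z\<close>, and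
    \<open>I\<close> avoids \<open>Z\<close>; hence the inner vertices of the link are new.\<close>
  have pvs: "set p \<inter> set vs = {}" "set p \<inter> Z = {}" using p(1) W(1) assms(4) by blast+
  have "successively (\<lambda>x y. E y x) (rev (a # p @ [b]))" using p(3) by (simp only: successively_rev)
  then have "successively E (rev (a # p @ [b]))" by (rule successively_mono) (rule sym)
  then have "successively E (b # rev p @ [a])" by simp
  moreover have "successively E (a # x2 @ ys @ z1 @ [b])"
    using vs(2) unfolding xs us x z
    by (auto simp: successively_append_iff successively_Cons hd_append)
  ultimately have "successively E (c @ [hd c])"
    unfolding c_def by (auto simp: successively_append_iff successively_Cons hd_append)
  moreover have dc: "distinct c" using vs(1) pvs p(2) unfolding c_def xs us x z by auto
  moreover have "set c \<inter> Z \<subseteq> U"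
  proof -
    have "set c \<subseteq> set vs \<union> set p" unfolding c_def xs us x z by auto
    then show ?thesis using pvs part(1) by auto
  qed
  moreover have "card U \<le> card (set c \<inter> Z) + 4 * s"
  proof -
    \<comment> \<open>All of \<open>ys\<close> lies on the cycle. The loss is fewer than
      \<open>2 * s\<close> vertices missed by the search and at most \<open>2 * s\<close> in
      \<open>xs\<close> and \<open>zs\<close>.\<close>
    have "length (filter ?P ys) \<le> card (set c \<inter> Z)"
      unfolding card_set_Int[OF dc] by (simp add: c_def)
    then show ?thesis using us(2) lus cv by linarith
  qed
  ultimately show ?thesis by (intro exI[of _ c]) (auto simp: c_def)
qed

section \<open>From vertex lists to cycles given by arcs\<close>

text \<open>Zipping a vertex list with its tail pairs consecutive vertices, which turns it into the
  arc list that the library expects of a walk.\<close>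

lemma cas_zip: "pcas x (zip (x # vs) vs) (last (x # vs))"
  by (induction vs arbitrary: x) auto

lemma awalk_verts_zip: "pawalk_verts x (zip (x # vs) vs) = x # vs"
  by (induction vs arbitrary: x) auto

lemma zip_subset_arcs:
  "successively (\<lambda>x y. (x, y) \<in> F) (x # vs) \<Longrightarrow> set (zip (x # vs) vs) \<subseteq> F"
  by (induction vs arbitrary: x) (auto simp: successively_Cons)

lemma graph_cycle_of_list:
  assumes "pair_graph H" "distinct c" "3 \<le> length c"
    and "successively (\<lambda>x y. (x, y) \<in> parcs H) (c @ [hd c])"
  shows "\<exists>C. graph_cycle H C \<and> cycle_verts C = set c"
proof -
  interpret pair_graph H by fact
  obtain x ws where c: "c = x # ws" using assms(3) by (cases c) auto
  define vs where "vs = ws @ [x]"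
  define C where "C = zip (x # vs) vs"
  have suc: "successively (\<lambda>x y. (x, y) \<in> parcs H) (x # vs)" using assms(4) c vs_def by simp
  have arcs: "set C \<subseteq> parcs H" unfolding C_def using zip_subset_arcs[OF suc] .
  have x: "x \<in> pverts H"
    using suc unfolding vs_def by (cases ws) (auto dest: in_arcsD1)
  have "pre_digraph.awalk (with_proj H) x C x"
    unfolding pre_digraph.awalk_def using arcs x cas_zip[of x vs]
    by (simp add: C_def vs_def)
  moreover have "distinct (tl (pre_digraph.awalk_verts (with_proj H) x C))"
    using assms(2) unfolding C_def awalk_verts_with_proj_eq awalk_verts_zip
    by (simp add: vs_def c)
  moreover have len: "length C = length c" by (simp add: C_def vs_def c)
  ultimately have "graph_cycle H C"
    unfolding graph_cycle_def pre_digraph.cycle_def using assms(3) by auto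
  moreover have "cycle_verts C = set c"
  proof -
    \<comment> \<open>\<open>zip\<close> drops the closing copy of \<open>x\<close>, so each vertex
      of \<open>c\<close> is the tail of exactly one arc.\<close>
    have "length c = length vs" "x # vs = c @ [x]" by (simp_all add: c vs_def)
    moreover from this have "C = zip c vs" unfolding C_def by (simp add: zip_append1)
    ultimately show ?thesis unfolding cycle_verts_def by (metis list.set_map map_fst_zip)
  qed
  ultimately show ?thesis by blast
qed

section \<open>Growth of balls in an expander after deleting vertices\<close>

text \<open>This is the ball of radius \<open>k\<close> about \<open>S \<inter> J\<close> in the
  graph induced on \<open>J\<close>. Writing \<open>hd (p @ [x])\<close> includes the trivial walk,
  where \<open>x\<close> itself is in \<open>S\<close>.\<close>

definition reach :: "('a \<Rightarrow> 'a \<Rightarrow> bool) \<Rightarrow> 'a set \<Rightarrow> 'a set \<Rightarrow> nat \<Rightarrow> 'a set" where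
  "reach E J S k = {x. \<exists>p. set p \<subseteq> J \<and> length p \<le> k \<and> hd (p @ [x]) \<in> S \<and> x \<in> J \<and> successively E (p @ [x])}"

lemma reach_subset: "reach E J S k \<subseteq> J"
  unfolding reach_def by auto

lemma start_subset_reach: "S \<subseteq> J \<Longrightarrow> S \<subseteq> reach E J S k"
  unfolding reach_def by (auto intro!: exI[of _ "[]"])

lemma reach_Suc:
  assumes "x \<in> reach E J S k" "E x y" "y \<in> J"
  shows "y \<in> reach E J S (Suc k)"
proof -
  from assms obtain p where p: "set p \<subseteq> J" "length p \<le> k" "hd (p @ [x]) \<in> S" "x \<in> J" "successively E (p @ [x])"
    unfolding reach_def by blast
  then show ?thesis unfolding reach_def mem_Collect_eq using \<open>E x y\<close> \<open>y \<in> J\<close>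
    by (intro exI[of _ "p @ [x]"]) (auto simp: successively_append_iff hd_append)
qed

lemma reach_mono: "reach E J S k \<subseteq> reach E J S (Suc k)"
  unfolding reach_def using le_SucI by blast

text \<open>While a ball fills at most half of \<open>V\<close>, expansion offers
  \<open>\<delta>\<close> times its size in new vertices, and \<open>F\<close> removes at most half
  of these. Each step therefore gains a factor \<open>1 + \<delta> / 2\<close>.\<close>

lemma card_reach:
  fixes \<delta> t :: real
  assumes "finite V" "S \<subseteq> V - F" "finite F"
    and expand: "\<And>X. X \<subseteq> V \<Longrightarrow> t \<le> card X \<Longrightarrow> real (card X) \<le> card V / 2 \<Longrightarrow>
      \<delta> * card X \<le> card {v \<in> V - X. \<exists>x\<in>X. E x v}"
    and "0 < \<delta>" "t \<le> card S" "card F \<le> \<delta> / 2 * card S"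
    and large: "card V < 2 * card S * (1 + \<delta> / 2) ^ k"
  shows "card V < 2 * card (reach E (V - F) S k)"
proof (rule ccontr)
  let ?R = "reach E (V - F) S"
  assume "\<not> ?thesis"
  then have small: "2 * card (?R k) \<le> card V" by simp
  have fin: "finite (?R j)" for j
    using reach_subset[of E "V - F" S j] \<open>finite V\<close> by (meson finite_Diff finite_subset)
  have "card S * (1 + \<delta> / 2) ^ j \<le> card (?R j)" if "j \<le> k" for j
    using that
  proof (induction j)
    case 0
    then show ?case using start_subset_reach[OF assms(2)] fin by (simp add: card_mono)
  next
    case (Suc j)
    let ?N = "{v \<in> V - ?R j. \<exists>x\<in>?R j. E x v}"
    \<comment> \<open>Earlier balls lie in the last one, so they too fill at most half of
      \<open>V\<close> and expansion applies to them.\<close>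
    have "mono ?R" using reach_mono by (rule mono_iff_le_Suc[THEN iffD2, rule_format])
    then have "?R j \<subseteq> ?R k" by (rule monoD) (use Suc.prems in simp)
    then have "card (?R j) \<le> card (?R k)" using fin by (intro card_mono)
    then have half: "real (card (?R j)) \<le> card V / 2" using small by linarith
    have SR: "card S \<le> card (?R j)" using start_subset_reach[OF assms(2)] fin by (intro card_mono)
    then have "\<delta> * card (?R j) \<le> card ?N"
      using half reach_subset[of E "V - F" S j] \<open>t \<le> card S\<close> by (intro expand) auto
    moreover have "real (card ?N) \<le> card (?N - F) + card F"
    proof -
      have "card ?N \<le> card ((?N - F) \<union> F)" using \<open>finite V\<close> \<open>finite F\<close> by (intro card_mono) auto
      also have "\<dots> \<le> card (?N - F) + card F" by (rule card_Un_le)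
      finally show ?thesis by linarith
    qed
    moreover have "card F \<le> \<delta> / 2 * card (?R j)"
    proof -
      have "\<delta> / 2 * card S \<le> \<delta> / 2 * card (?R j)" using SR \<open>0 < \<delta>\<close> by (intro mult_left_mono) auto
      then show ?thesis using assms(7) by linarith
    qed
    moreover have "card (?R j) + card (?N - F) \<le> card (?R (Suc j))"
    proof -
      have "?R j \<union> (?N - F) \<subseteq> ?R (Suc j)"
        using reach_mono[of E "V - F" S j] reach_Suc[of _ E "V - F" S j] by blast
      then have "card (?R j \<union> (?N - F)) \<le> card (?R (Suc j))" using fin by (rule card_mono[rotated])
      moreover have "card (?R j \<union> (?N - F)) = card (?R j) + card (?N - F)"
        using fin \<open>finite V\<close> by (intro card_Un_disjoint) auto
      ultimately show ?thesis by simp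
    qed
    ultimately have "(1 + \<delta> / 2) * card (?R j) \<le> card (?R (Suc j))" by (simp add: algebra_simps)
    moreover have "(1 + \<delta> / 2) * (card S * (1 + \<delta> / 2) ^ j) \<le> (1 + \<delta> / 2) * card (?R j)"
      using Suc \<open>0 < \<delta>\<close> by (intro mult_left_mono) auto
    ultimately show ?case by (simp add: algebra_simps)
  qed
  from this[of k] show False using large small by simp
qed

lemma joined_if_reach_intersect:
  assumes sym: "\<And>x y. E x y \<Longrightarrow> E y x"
    and x: "x \<in> reach E J {v \<in> V. \<exists>a\<in>A. E a v} k" "x \<in> reach E J {v \<in> V. \<exists>b\<in>B. E b v} k"
  shows "\<exists>a\<in>A. \<exists>b\<in>B. joined E J (2 * k + 1) a b"
proof -
  obtain p q where p: "set p \<subseteq> J" "length p \<le> k" "hd (p @ [x]) \<in> {v \<in> V. \<exists>a\<in>A. E a v}" "x \<in> J"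
      "successively E (p @ [x])"
    and q: "set q \<subseteq> J" "length q \<le> k" "hd (q @ [x]) \<in> {v \<in> V. \<exists>b\<in>B. E b v}"
      "successively E (q @ [x])"
    using x unfolding reach_def by blast
  obtain a b where ab: "a \<in> A" "b \<in> B" "E a (hd (p @ [x]))" "E b (hd (q @ [x]))" using p q by auto
  have "successively E (b # q @ [x])" using q ab by (simp add: successively_Cons)
  then have "successively (\<lambda>x y. E y x) (rev (b # q @ [x]))" by (simp only: successively_rev)
  then have "successively E (rev (b # q @ [x]))" by (rule successively_mono) (rule sym)
  moreover have "successively E (a # p @ [x])" using p ab by (simp add: successively_Cons)
  ultimately have "successively E (a # (p @ x # rev q) @ [b])"
    by (auto simp: successively_append_iff successively_Cons hd_append)
  \<comment> \<open>The two halves may cross, so this is only a walk. It has at most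
    \<open>k\<close> inner vertices on either side of \<open>x\<close>.\<close>
  then have "joined E J (2 * k + 1) a b" by (rule joined_if_walk) (use p q in auto)
  then show ?thesis using ab by blast
qed

lemma reach_start_mono: "S \<subseteq> T \<Longrightarrow> reach E J S k \<subseteq> reach E J T k"
  unfolding reach_def by blast

text \<open>The balls about the neighbourhoods of \<open>A\<close> and of \<open>B\<close> each fill
  more than half of \<open>V\<close>, so they meet.\<close>

lemma joined_if_expanding:
  fixes \<delta> t r :: real
  assumes "finite V" "finite F" and sym: "\<And>x y. E x y \<Longrightarrow> E y x"
    and expand: "\<And>X. X \<subseteq> V \<Longrightarrow> t \<le> card X \<Longrightarrow> real (card X) \<le> card V / 2 \<Longrightarrow>
      \<delta> * card X \<le> card {v \<in> V - X. \<exists>x\<in>X. E x v}"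
    and "0 < \<delta>" "\<delta> \<le> 1"
    and A: "r \<le> card {v \<in> V. \<exists>a\<in>A. E a v}" and B: "r \<le> card {v \<in> V. \<exists>b\<in>B. E b v}"
    and r: "2 * t \<le> r" "card F \<le> \<delta> / 4 * r" "card V < r * (1 + \<delta> / 2) ^ k"
  shows "\<exists>a\<in>A. \<exists>b\<in>B. joined E (V - F) (2 * k + 1) a b"
proof -
  have r0: "0 \<le> r"
  proof -
    have "0 \<le> \<delta> / 4 * r" using r(2) by linarith
    then show ?thesis using \<open>0 < \<delta>\<close> by (simp add: zero_le_mult_iff)
  qed
  have big: "card V < 2 * card (reach E (V - F) {v \<in> V. \<exists>a\<in>A. E a v} k)"
    if A: "r \<le> card {v \<in> V. \<exists>a\<in>A. E a v}" for A
  proof -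
    let ?N = "{v \<in> V. \<exists>a\<in>A. E a v}"
    let ?S = "?N - F"
    have "card ?N \<le> card (?S \<union> F)" using \<open>finite V\<close> \<open>finite F\<close> by (intro card_mono) auto
    also have "\<dots> \<le> card ?S + card F" by (rule card_Un_le)
    finally have "card ?N \<le> card ?S + card F" .
    moreover have "\<delta> / 4 * r \<le> 1 / 4 * r" using \<open>\<delta> \<le> 1\<close> r0 by (intro mult_right_mono) auto
    \<comment> \<open>\<open>F\<close> has at most \<open>r / 4\<close> elements, so more than
      enough of the neighbourhood survives its deletion.\<close>
    ultimately have S: "r / 2 \<le> card ?S" using A r r0 by linarith
    have "card V < 2 * card (reach E (V - F) ?S k)"
    proof (rule card_reach[where t = t and \<delta> = \<delta>])
      have "\<delta> / 2 * (r / 2) \<le> \<delta> / 2 * card ?S" using S \<open>0 < \<delta>\<close> by (intro mult_left_mono) auto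
      then show "card F \<le> \<delta> / 2 * card ?S" using r(2) by simp
      have "r * (1 + \<delta> / 2) ^ k \<le> 2 * card ?S * (1 + \<delta> / 2) ^ k"
        using S \<open>0 < \<delta>\<close> by (intro mult_right_mono) auto
      then show "card V < 2 * card ?S * (1 + \<delta> / 2) ^ k" using r(3) by simp
    qed (use expand assms(1,2,5) r(1) S in auto)
    also have "\<dots> \<le> 2 * card (reach E (V - F) ?N k)"
    proof -
      have "finite (reach E (V - F) ?N k)"
        using \<open>finite V\<close> by (intro finite_subset[OF reach_subset]) auto
      then show ?thesis by (intro mult_left_mono card_mono reach_start_mono) auto
    qed
    finally show ?thesis .
  qed
  let ?X = "reach E (V - F) {v \<in> V. \<exists>a\<in>A. E a v} k" and ?Y = "reach E (V - F) {v \<in> V. \<exists>b\<in>B. E b v} k"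
  have "?X \<inter> ?Y \<noteq> {}"
  proof
    assume e: "?X \<inter> ?Y = {}"
    have sub: "?X \<union> ?Y \<subseteq> V" using reach_subset by fast
    then have "card (?X \<union> ?Y) = card ?X + card ?Y"
      using e \<open>finite V\<close> by (intro card_Un_disjoint) (auto intro: finite_subset)
    moreover have "card (?X \<union> ?Y) \<le> card V" using sub \<open>finite V\<close> by (rule card_mono[rotated])
    ultimately show False using big[OF A] big[OF B] by linarith
  qed
  then obtain x where x: "x \<in> ?X" "x \<in> ?Y" by blast
  show ?thesis by (rule joined_if_reach_intersect[OF _ x]) (rule sym)
qed

section \<open>Greedy choice of a set with large neighbourhoods\<close>

text \<open>Adding \<open>z\<close> raises the sum of squares by the degree of \<open>z\<close> plus
  twice a cross term. Averaging over the vertices outside \<open>Z\<close> yields a \<open>z\<close>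
  with a small cross term.\<close>

lemma spread_set:
  fixes D :: real
  assumes "finite V" and sym: "\<And>x y. E x y \<Longrightarrow> E y x" and "0 \<le> D"
    and deg: "\<And>v. v \<in> V \<Longrightarrow> card {w \<in> V. E v w} \<le> D"
    and k: "2 * k \<le> card V"
  shows "\<exists>Z\<subseteq>V. card Z = k \<and>
    (\<Sum>v\<in>V. (\<Sum>z\<in>Z. of_bool (E z v))\<^sup>2) \<le> k * (D + 4 * real k * D\<^sup>2 / card V)"
proof -
  define g where "g z v = (of_bool (E z v) :: real)" for z v
  have degg: "(\<Sum>v\<in>V. g z v) \<le> D" if "z \<in> V" for z
  proof -
    have "(\<Sum>v\<in>V. g z v) = card {w \<in> V. E z w}"
      unfolding g_def using \<open>finite V\<close> by (simp add: Int_def)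
    then show ?thesis using deg[OF that] by simp
  qed
  have gsym: "g z v = g v z" for z v unfolding g_def using sym by (metis of_bool_eq_iff)
  have "\<exists>Z\<subseteq>V. card Z = j \<and> (\<Sum>v\<in>V. (\<Sum>z\<in>Z. g z v)\<^sup>2) \<le> j * (D + 4 * real k * D\<^sup>2 / card V)"
    if "j \<le> k" for j
    using that
  proof (induction j)
    case 0
    then show ?case by (intro exI[of _ "{}"]) auto
  next
    case (Suc j)
    then obtain Z where Z: "Z \<subseteq> V" "card Z = j"
      and IH: "(\<Sum>v\<in>V. (\<Sum>z\<in>Z. g z v)\<^sup>2) \<le> j * (D + 4 * real k * D\<^sup>2 / card V)" by auto
    define f where "f v = (\<Sum>z\<in>Z. g z v)" for v
    \<comment> \<open>The cross terms sum to at most \<open>k * D\<^sup>2\<close>, and at least half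
      of \<open>V\<close> is still available; \<open>c\<close> is the resulting bound on their
      average.\<close>
    define c where "c = 2 * k * D\<^sup>2 / card V"
    have finZ: "finite Z" using Z \<open>finite V\<close> finite_subset by blast
    have f0: "0 \<le> f v" for v unfolding f_def g_def by (intro sum_nonneg) auto
    have n: "card V > 0" using k Suc.prems by linarith
    have "\<exists>z\<in>V - Z. (\<Sum>v\<in>V. g z v * f v) \<le> c"
    proof (rule ccontr)
      assume "\<not> ?thesis"
      then have "\<And>z. z \<in> V - Z \<Longrightarrow> c < (\<Sum>v\<in>V. g z v * f v)" by force
      moreover have cVZ: "card (V - Z) = card V - j" using Z finZ by (simp add: card_Diff_subset)
      then have "V - Z \<noteq> {}"
        using k Suc.prems by (metis card.empty diff_is_0_eq not_less_eq_eq le_trans mult_2 le_add1)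
      ultimately have "(\<Sum>z\<in>V - Z. c) < (\<Sum>z\<in>V - Z. \<Sum>v\<in>V. g z v * f v)"
        using \<open>finite V\<close> by (intro sum_strict_mono) auto
      also have "\<dots> \<le> (\<Sum>z\<in>V. \<Sum>v\<in>V. g z v * f v)"
        using \<open>finite V\<close> f0 by (intro sum_mono2 sum_nonneg) (auto simp: g_def)
      \<comment> \<open>The double sum counts walks of length two starting in \<open>Z\<close>; the
        degree bound is applied to the middle vertex and then to the start.\<close>
      also have "\<dots> = (\<Sum>v\<in>V. f v * (\<Sum>z\<in>V. g v z))"
        by (subst sum.swap) (simp add: sum_distrib_left gsym mult.commute)
      also have "\<dots> \<le> (\<Sum>v\<in>V. f v * D)"
        using degg f0 by (intro sum_mono mult_left_mono) auto
      also have "\<dots> = (\<Sum>z\<in>Z. \<Sum>v\<in>V. g z v) * D"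
        unfolding f_def by (subst sum.swap) (simp add: sum_distrib_right)
      also have "\<dots> \<le> (\<Sum>z\<in>Z. D) * D"
        using degg Z \<open>0 \<le> D\<close> by (intro sum_mono mult_right_mono) auto
      also have "\<dots> = j * D\<^sup>2" using Z by (simp add: power2_eq_square)
      also have "\<dots> \<le> k * D\<^sup>2" using Suc.prems by (intro mult_right_mono) auto
      also have "\<dots> = card V / 2 * c" using n unfolding c_def by simp
      also have "\<dots> \<le> (\<Sum>z\<in>V - Z. c)"
      proof -
        have "real (card V) / 2 \<le> real (card (V - Z))" unfolding cVZ using k Suc.prems by linarith
        then have "card V / 2 * c \<le> card (V - Z) * c"
          using \<open>0 \<le> D\<close> by (intro mult_right_mono) (auto simp: c_def)
        then show ?thesis by simp
      qed
      finally show False by simp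
    qed
    then obtain z where z: "z \<in> V" "z \<notin> Z" "(\<Sum>v\<in>V. g z v * f v) \<le> c" by blast
    \<comment> \<open>Since \<open>g\<close> takes the values 0 and 1, its square is
      \<open>g\<close> itself.\<close>
    have "(\<Sum>v\<in>V. (\<Sum>z\<in>insert z Z. g z v)\<^sup>2) = (\<Sum>v\<in>V. (f v)\<^sup>2 + 2 * (g z v * f v) + g z v)"
      using z finZ by (intro sum.cong) (auto simp: f_def g_def power2_eq_square algebra_simps)
    also have "\<dots> = (\<Sum>v\<in>V. (f v)\<^sup>2) + 2 * (\<Sum>v\<in>V. g z v * f v) + (\<Sum>v\<in>V. g z v)"
      by (simp add: sum.distrib sum_distrib_left)
    also have "\<dots> \<le> j * (D + 4 * real k * D\<^sup>2 / card V) + 2 * c + D"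
      using IH z degg[OF z(1)] unfolding f_def by linarith
    also have "\<dots> = Suc j * (D + 4 * real k * D\<^sup>2 / card V)"
      unfolding c_def by (simp add: algebra_simps add_divide_distrib)
    finally show ?case using z Z finZ by (intro exI[of _ "insert z Z"]) auto
  qed
  from this[of k] show ?thesis unfolding g_def by simp
qed

text \<open>Cauchy--Schwarz for the number of edges leaving \<open>A\<close>, which is at least
  \<open>card A * \<delta>\<close>. Counting from all of \<open>Z\<close> on the other side makes
  \<open>\<Phi>\<close> serve every \<open>A\<close> at once.\<close>

lemma card_nbhd_of_spread_set:
  fixes \<delta> \<Phi> :: real
  assumes "finite V" "Z \<subseteq> V" "A \<subseteq> Z" "0 \<le> \<delta>"
    and spread: "(\<Sum>v\<in>V. (\<Sum>z\<in>Z. of_bool (E z v))\<^sup>2) \<le> \<Phi>"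
    and deg: "\<And>v. v \<in> V \<Longrightarrow> \<delta> \<le> card {w \<in> V. E v w}"
  shows "(card A * \<delta>)\<^sup>2 \<le> \<Phi> * card {v \<in> V. \<exists>a\<in>A. E a v}"
proof -
  define g where "g z v = (of_bool (E z v) :: real)" for z v
  let ?N = "{v \<in> V. \<exists>a\<in>A. E a v}"
  have finZ: "finite Z" using assms finite_subset by blast
  have "card A * \<delta> = (\<Sum>z\<in>A. \<delta>)" by simp
  also have "\<dots> \<le> (\<Sum>z\<in>A. \<Sum>v\<in>V. g z v)"
  proof (intro sum_mono)
    fix z assume "z \<in> A"
    moreover have "(\<Sum>v\<in>V. g z v) = card {w \<in> V. E z w}"
      unfolding g_def using \<open>finite V\<close> by (simp add: Int_def)
    ultimately show "\<delta> \<le> (\<Sum>v\<in>V. g z v)" using deg[of z] assms by auto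
  qed
  also have "\<dots> = (\<Sum>v\<in>V. \<Sum>z\<in>A. g z v)" by (rule sum.swap)
  also have "\<dots> = (\<Sum>v\<in>?N. \<Sum>z\<in>A. g z v)"
    using \<open>finite V\<close> by (intro sum.mono_neutral_right) (auto simp: g_def)
  also have "\<dots> \<le> (\<Sum>v\<in>?N. \<Sum>z\<in>Z. g z v)"
    using finZ assms by (intro sum_mono sum_mono2) (auto simp: g_def)
  finally have "(card A * \<delta>)\<^sup>2 \<le> (\<Sum>v\<in>?N. \<Sum>z\<in>Z. g z v)\<^sup>2"
    using \<open>0 \<le> \<delta>\<close> by (intro power_mono) auto
  also have "\<dots> \<le> (\<Sum>v\<in>?N. (\<Sum>z\<in>Z. g z v)\<^sup>2) * card ?N" by (rule sum_squared_le_sum_of_squares)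
  also have "\<dots> \<le> (\<Sum>v\<in>V. (\<Sum>z\<in>Z. g z v)\<^sup>2) * card ?N"
    using \<open>finite V\<close> by (intro mult_right_mono sum_mono2) auto
  also have "\<dots> \<le> \<Phi> * card ?N" using spread unfolding g_def by (intro mult_right_mono) auto
  finally show ?thesis .
qed

section \<open>Quantitative estimates and assembly of the cycles\<close>

text \<open>For such \<open>x\<close>, \<open>ln (1 + x)\<close> is at least
  \<open>x - x\<^sup>2\<close> and hence at least \<open>x / 2\<close>.\<close>

lemma exp_le_one_plus_power:
  fixes x :: real
  assumes "0 \<le> x" "x \<le> 1 / 2"
  shows "exp (k * (x / 2)) \<le> (1 + x) ^ k"
proof -
  have "x / 2 \<le> x - x\<^sup>2"
    using mult_left_mono[OF assms(2,1)] by (simp add: power2_eq_square)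
  also have "\<dots> \<le> ln (1 + x)" using assms by (intro ln_one_plus_pos_lower_bound) auto
  finally have "exp (x / 2) \<le> 1 + x" using assms(1) ln_ge_iff[of "1 + x" "x / 2"] by linarith
  then have "exp (x / 2) ^ k \<le> (1 + x) ^ k" by (intro power_mono) auto
  then show ?thesis by (simp only: exp_of_nat_mult)
qed

lemma (in pair_graph) out_degree_eq_card_nbhd:
  "out_degree (with_proj G) v = card {w \<in> pverts G. (v, w) \<in> parcs G}"
proof -
  have "out_arcs (with_proj G) v = Pair v ` {w \<in> pverts G. (v, w) \<in> parcs G}"
    unfolding out_arcs_def by (auto dest: in_arcsD2)
  then show ?thesis unfolding out_degree_def by (simp add: card_image inj_on_def)
qed

text \<open>The expansion rate decreases in the size of \<open>X\<close>, so its value at the full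
  vertex count is a common lower bound. From \<open>t / 2\<close> on, the argument of the logarithm
  is at least \<open>15 / 2\<close>, which keeps the logarithm positive.\<close>

lemma expander_uniform:
  assumes "expander \<epsilon> t G" "0 < \<epsilon>" "0 < t" and X: "X \<subseteq> pverts G"
    and "t / 2 \<le> card X" "card X \<le> card (pverts G) / 2"
  shows "\<epsilon> / (ln (15 * real (card (pverts G)) / t))\<^sup>2 * card X \<le> card (ext_nbhd G X)"
proof -
  have "15 * (t / 2) / t \<le> 15 * real (card X) / t"
    using assms by (intro divide_right_mono mult_left_mono) auto
  moreover have "15 * (t / 2) / t = 15 / 2" using \<open>0 < t\<close> by simp
  ultimately have one: "1 < 15 * real (card X) / t" by linarith
  have "15 * real (card X) / t \<le> 15 * real (card (pverts G)) / t"
    using assms(3,6) by (intro divide_right_mono) auto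
  then have "ln (15 * real (card X) / t) \<le> ln (15 * real (card (pverts G)) / t)"
    using one by (subst ln_le_cancel_iff) auto
  moreover have pos: "0 < ln (15 * real (card X) / t)" using one by (rule ln_gt_zero)
  ultimately have "\<epsilon> / (ln (15 * real (card (pverts G)) / t))\<^sup>2 \<le> \<epsilon> / (ln (15 * real (card X) / t))\<^sup>2"
    using \<open>0 < \<epsilon>\<close> by (intro divide_left_mono power_mono mult_pos_pos) auto
  also have "\<dots> = expansion \<epsilon> t (card X)" unfolding expansion_def using assms by auto
  finally have "\<epsilon> / (ln (15 * real (card (pverts G)) / t))\<^sup>2 * card X \<le> expansion \<epsilon> t (card X) * card X"
    by (intro mult_right_mono) auto
  then show ?thesis using assms unfolding expander_def by (meson order_trans)
qed

text \<open>
  The constants in the hypotheses on \<open>l ^ 5\<close> are \<open>3200 * 5600 * 200\<close> and \<open>3200 * 5600 * 160000\<close>: \<open>5600\<close> is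
  the size of the neighbourhoods needed for linking, in units of \<open>d * l ^ 5 / \<epsilon>\<^sup>2\<close>, and each of the
  two terms of \<open>\<Phi>\<close> below must contribute at most half of \<open>d ^ 4 / 1600 = (d / 4 * (d / 10))\<^sup>2\<close>.
\<close>

lemma robust_cycles:
  fixes \<epsilon> L d :: real and H :: "'a pair_pre_digraph"
  defines "n \<equiv> card (pverts H)"
  defines "l \<equiv> ln (450 * real n / d)"
  assumes "0 < \<epsilon>" "\<epsilon> \<le> 1" "1 \<le> L" "5 \<le> d" "400 * d \<le> n"
    and l1: "3584000000 * L / \<epsilon>\<^sup>2 * l ^ 5 \<le> d"
    and l2: "2867200000000 * L\<^sup>2 / \<epsilon>\<^sup>2 * l ^ 5 \<le> n / d"
    and H: "pair_graph H" "expander \<epsilon> (d / 30) H"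
    and min: "\<And>v. v \<in> pverts H \<Longrightarrow> d / 10 \<le> out_degree (with_proj H) v"
    and max: "\<And>v. v \<in> pverts H \<Longrightarrow> out_degree (with_proj H) v \<le> L * d"
  shows "\<exists>Z \<subseteq> pverts H. card Z = nat \<lfloor>200 * d\<rfloor> \<and>
      (\<forall>U \<subseteq> Z. card U = nat \<lfloor>100 * d\<rfloor> \<longrightarrow>
        (\<exists>C. graph_cycle H C \<and> cycle_verts C \<inter> Z \<subseteq> U \<and>
             98 * d \<le> real (card (cycle_verts C \<inter> Z))))"
proof -
  interpret pair_graph H by fact
  let ?V = "pverts H" and ?E = "\<lambda>x y. (x, y) \<in> parcs H"
  note deg = out_degree_eq_card_nbhd
  have finV: "finite ?V" by (rule pair_finite_verts)
  have sym: "?E y x" if "?E x y" for x y using that pair_sym_arcs by (meson arcs_symmetric)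
  have n0: "0 < n" using \<open>5 \<le> d\<close> \<open>400 * d \<le> n\<close> by linarith
  \<comment> \<open>\<open>450 = 15 * 30\<close>, because the expander parameter is
    \<open>d / 30\<close>.\<close>
  have exp_l: "exp l = 450 * real n / d" unfolding l_def using n0 \<open>5 \<le> d\<close> by (intro exp_ln) simp
  have "exp 1 \<le> 450 * real n / d"
  proof -
    have "3 \<le> 450 * real n / d" using \<open>5 \<le> d\<close> \<open>400 * d \<le> n\<close> by (simp add: field_simps)
    then show ?thesis using exp_le by linarith
  qed
  then have l: "1 \<le> l" using exp_l by (metis exp_le_cancel_iff)
  define k where "k = nat \<lfloor>200 * d\<rfloor>"
  \<comment> \<open>The bound of \<open>spread_set\<close> for maximum degree \<open>L * d\<close>
    and \<open>k = 200 * d\<close>.\<close>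
  define \<Phi> where "\<Phi> = 200 * L * d\<^sup>2 + 160000 * L\<^sup>2 * d ^ 4 / n"
  have k: "k \<le> 200 * d" unfolding k_def using \<open>5 \<le> d\<close> by (simp add: of_nat_nat)
  have "\<exists>Z\<subseteq>?V. card Z = k \<and>
    (\<Sum>v\<in>?V. (\<Sum>z\<in>Z. of_bool (?E z v))\<^sup>2) \<le> k * (L * d + 4 * real k * (L * d)\<^sup>2 / card ?V)"
  proof (rule spread_set)
    show "2 * k \<le> card ?V" using k \<open>400 * d \<le> n\<close> unfolding n_def by linarith
    show "real (card {w \<in> ?V. ?E v w}) \<le> L * d" if "v \<in> ?V" for v using max[OF that] deg by simp
    show "?E y x" if "?E x y" for x y using that by (rule sym)
  qed (use finV \<open>5 \<le> d\<close> \<open>1 \<le> L\<close> in auto)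
  then obtain Z where Z: "Z \<subseteq> ?V" "card Z = k" and
    spread0: "(\<Sum>v\<in>?V. (\<Sum>z\<in>Z. of_bool (?E z v))\<^sup>2) \<le> k * (L * d + 4 * real k * (L * d)\<^sup>2 / card ?V)"
    by blast
  have "k * (L * d + 4 * real k * (L * d)\<^sup>2 / n) \<le> 200 * d * (L * d + 4 * (200 * d) * (L * d)\<^sup>2 / n)"
    using k \<open>5 \<le> d\<close> \<open>1 \<le> L\<close>
    by (intro mult_mono add_mono divide_right_mono mult_right_mono mult_left_mono) auto
  also have "\<dots> = \<Phi>" unfolding \<Phi>_def by (simp add: field_simps power2_eq_square power4_eq_xxxx)
  finally have spread: "(\<Sum>v\<in>?V. (\<Sum>z\<in>Z. of_bool (?E z v))\<^sup>2) \<le> \<Phi>"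
    using spread0 unfolding n_def by linarith
  have \<Phi>0: "0 < \<Phi>" unfolding \<Phi>_def using \<open>5 \<le> d\<close> \<open>1 \<le> L\<close> n0 by (intro add_pos_pos) auto
  \<comment> \<open>With \<open>\<delta> = \<epsilon> / l\<^sup>2\<close> this makes
    \<open>\<delta> / 4 * r\<close> equal to \<open>1400 * d * l ^ 3 / \<epsilon>\<close>, enough
    for the deleted vertices: at most 1100 such units in \<open>W\<close> and 200 in
    \<open>Z\<close>.\<close>
  define r where "r = 5600 * d * l ^ 5 / \<epsilon>\<^sup>2"
  have r\<Phi>: "r * \<Phi> \<le> d ^ 4 / 1600"
  proof -
    have "r * \<Phi> = (3584000000 * L / \<epsilon>\<^sup>2 * l ^ 5) * (d ^ 3 / 3200)
        + (2867200000000 * L\<^sup>2 / \<epsilon>\<^sup>2 * l ^ 5) * (d ^ 5 / (3200 * n))"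
      unfolding r_def \<Phi>_def using \<open>0 < \<epsilon>\<close> n0 by (simp add: field_simps power_numeral_reduce)
    also have "\<dots> \<le> d * (d ^ 3 / 3200) + n / d * (d ^ 5 / (3200 * n))"
      using l1 l2 \<open>5 \<le> d\<close> by (intro add_mono mult_right_mono) auto
    also have "\<dots> = d ^ 4 / 1600"
      using \<open>5 \<le> d\<close> n0 by (simp add: field_simps power_numeral_reduce)
    finally show ?thesis .
  qed
  have nbhd: "r \<le> card {v \<in> ?V. \<exists>a\<in>A. ?E a v}" if A: "A \<subseteq> Z" "d / 4 \<le> card A" for A
  proof -
    have "d ^ 4 / 1600 = (d / 4 * (d / 10))\<^sup>2" by (simp add: field_simps power_numeral_reduce)
    also have "\<dots> \<le> (card A * (d / 10))\<^sup>2"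
      using A \<open>5 \<le> d\<close> by (intro power_mono mult_right_mono) auto
    also have "\<dots> \<le> \<Phi> * card {v \<in> ?V. \<exists>a\<in>A. ?E a v}"
      using min deg \<open>5 \<le> d\<close> by (intro card_nbhd_of_spread_set[OF finV Z(1) A(1) _ spread]) auto
    finally have "\<Phi> * r \<le> \<Phi> * card {v \<in> ?V. \<exists>a\<in>A. ?E a v}" using r\<Phi> by (simp add: mult.commute)
    then show ?thesis using \<Phi>0 by simp
  qed
  define \<delta> where "\<delta> = \<epsilon> / l\<^sup>2"
  have \<delta>: "0 < \<delta>" "\<delta> \<le> 1"
  proof -
    show "0 < \<delta>" unfolding \<delta>_def using l \<open>0 < \<epsilon>\<close> by simp
    have "\<epsilon> \<le> l\<^sup>2" using one_le_power[OF l, of 2] \<open>\<epsilon> \<le> 1\<close> by linarith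
    then show "\<delta> \<le> 1" unfolding \<delta>_def using l by (subst divide_le_eq_1_pos) auto
  qed
  have expand: "\<delta> * card X \<le> card {v \<in> ?V - X. \<exists>x\<in>X. ?E x v}"
    if "X \<subseteq> ?V" "d / 60 \<le> card X" "card X \<le> card ?V / 2" for X
    using expander_uniform[OF H(2) \<open>0 < \<epsilon>\<close> _ that(1) _ that(3)] that(2) \<open>5 \<le> d\<close>
    unfolding \<delta>_def l_def n_def ext_nbhd_def by (simp add: mult.commute)
  \<comment> \<open>A step multiplies by at least \<open>exp (\<delta> / 4)\<close>, so
    \<open>4 * l / \<delta>\<close> steps give the factor
    \<open>exp l = 450 * n / d\<close>.\<close>
  define q where "q = nat \<lceil>4 * l ^ 3 / \<epsilon>\<rceil>"
  have l3: "1 \<le> l ^ 3 / \<epsilon>"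
  proof -
    have "\<epsilon> \<le> l ^ 3" using one_le_power[OF l, of 3] \<open>\<epsilon> \<le> 1\<close> by linarith
    then show ?thesis using \<open>0 < \<epsilon>\<close> by (subst le_divide_eq_1_pos)
  qed
  have q: "4 * l ^ 3 / \<epsilon> \<le> q" "q \<le> 5 * (l ^ 3 / \<epsilon>)" unfolding q_def using l3 by linarith+
  have r0: "5600 * d \<le> r"
  proof -
    have "\<epsilon>\<^sup>2 \<le> 1" using \<open>0 < \<epsilon>\<close> \<open>\<epsilon> \<le> 1\<close> by (intro power_le_one) auto
    then have "\<epsilon>\<^sup>2 \<le> l ^ 5" using one_le_power[OF l, of 5] by linarith
    then have "1 \<le> l ^ 5 / \<epsilon>\<^sup>2" using \<open>0 < \<epsilon>\<close> by (subst le_divide_eq_1_pos) auto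
    then have "5600 * d * 1 \<le> 5600 * d * (l ^ 5 / \<epsilon>\<^sup>2)" using \<open>5 \<le> d\<close> by (intro mult_left_mono) auto
    then show ?thesis unfolding r_def by simp
  qed
  have grow: "n < r * (1 + \<delta> / 2) ^ q"
  proof -
    have "l = (4 * l ^ 3 / \<epsilon>) * (\<delta> / 2 / 2)"
      unfolding \<delta>_def using l \<open>0 < \<epsilon>\<close> by (simp add: field_simps power_numeral_reduce)
    also have "\<dots> \<le> q * (\<delta> / 2 / 2)" using q \<delta> by (intro mult_right_mono) auto
    finally have "450 * real n / d \<le> exp (q * (\<delta> / 2 / 2))" using exp_l by (metis exp_le_cancel_iff)
    also have "\<dots> \<le> (1 + \<delta> / 2) ^ q" using \<delta> by (intro exp_le_one_plus_power) auto
    finally have "5600 * d * (450 * real n / d) \<le> r * (1 + \<delta> / 2) ^ q"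
      using r0 \<open>5 \<le> d\<close> by (intro mult_mono) auto
    moreover have "5600 * d * (450 * real n / d) = 2520000 * n" using \<open>5 \<le> d\<close> by simp
    ultimately show ?thesis using n0 by simp
  qed
  \<comment> \<open>The cycle loses at most \<open>4 * s\<close>, hence at most
    \<open>d + 4\<close>, and rounding \<open>100 * d\<close> loses at most 1;
    \<open>5 \<le> d\<close> then leaves \<open>98 * d\<close>.\<close>
  define s where "s = nat \<lceil>d / 4\<rceil>"
  have s: "d / 4 \<le> s" "s \<le> d / 4 + 1" unfolding s_def using \<open>5 \<le> d\<close> by linarith+
  have cycles: "\<exists>C. graph_cycle H C \<and> cycle_verts C \<inter> Z \<subseteq> U \<and> 98 * d \<le> card (cycle_verts C \<inter> Z)"
    if U: "U \<subseteq> Z" "card U = nat \<lfloor>100 * d\<rfloor>" for U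
  proof -
    have cU: "100 * d - 1 \<le> card U" "card U \<le> 100 * d" using U(2) \<open>5 \<le> d\<close> by linarith+
    have finZ: "finite Z" using Z finV finite_subset by blast
    have "\<exists>c. c \<noteq> [] \<and> distinct c \<and> successively ?E (c @ [hd c]) \<and> set c \<inter> Z \<subseteq> U \<and>
      card U \<le> card (set c \<inter> Z) + 4 * s"
    proof (rule cycle_if_linked[where I = "?V - Z" and m = "2 * q + 1"])
      show "4 * s \<le> card U" using cU s \<open>5 \<le> d\<close> by linarith
      fix A B W
      assume AB: "A \<subseteq> Z" "B \<subseteq> Z" "s \<le> card A" "s \<le> card B"
        and W: "W \<subseteq> ?V - Z" "card W \<le> (2 * q + 1) * card U"
      have finW: "finite W" using W finV by (meson finite_Diff finite_subset)
      \<comment> \<open>Deleting all of \<open>Z\<close> as well keeps the inner vertices of a link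
        outside \<open>Z\<close>; \<open>A\<close> and \<open>B\<close> supply only its
        ends.\<close>
      have "\<exists>a\<in>A. \<exists>b\<in>B. joined ?E (?V - (W \<union> Z)) (2 * q + 1) a b"
      proof (rule joined_if_expanding[where t = "d / 60" and \<delta> = \<delta> and r = r])
        show "r \<le> card {v \<in> ?V. \<exists>a\<in>A. ?E a v}" using AB s by (intro nbhd) auto
        show "r \<le> card {v \<in> ?V. \<exists>b\<in>B. ?E b v}" using AB s by (intro nbhd) auto
        show "2 * (d / 60) \<le> r" using r0 \<open>5 \<le> d\<close> by linarith
        show "card ?V < r * (1 + \<delta> / 2) ^ q" using grow unfolding n_def .
        have "real (card W) \<le> real (2 * q + 1) * real (card U)" using W(2) by (metis of_nat_le_iff of_nat_mult)
        also have "\<dots> \<le> (11 * (l ^ 3 / \<epsilon>)) * (100 * d)"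
          using q(2) l3 cU by (intro mult_mono) auto
        finally have "card W \<le> 1100 * d * (l ^ 3 / \<epsilon>)" by (simp add: algebra_simps)
        moreover have "200 * d * 1 \<le> 200 * d * (l ^ 3 / \<epsilon>)" using l3 \<open>5 \<le> d\<close> by (intro mult_left_mono) auto
        moreover have "card (W \<union> Z) \<le> card W + card Z" by (rule card_Un_le)
        ultimately have "card (W \<union> Z) \<le> 1300 * d * (l ^ 3 / \<epsilon>)"
          using Z(2) k by linarith
        also have "\<dots> \<le> 1400 * d * (l ^ 3 / \<epsilon>)" using l3 \<open>5 \<le> d\<close> by (intro mult_right_mono) auto
        also have "\<dots> = \<delta> / 4 * r"
          unfolding \<delta>_def r_def using l \<open>0 < \<epsilon>\<close> by (simp add: field_simps power_numeral_reduce)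
        finally show "card (W \<union> Z) \<le> \<delta> / 4 * r" .
        show "?E y x" if "?E x y" for x y using that by (rule sym)
      qed (use finV finW finZ expand \<delta> in auto)
      moreover have "?V - (W \<union> Z) = ?V - Z - W" by blast
      ultimately show "\<exists>a\<in>A. \<exists>b\<in>B. joined ?E (?V - Z - W) (2 * q + 1) a b" by simp
    next
      show "?E y x" if "?E x y" for x y using that by (rule sym)
    qed (use U finZ finV in \<open>auto intro: finite_subset\<close>)
    then obtain c where c: "distinct c" "successively ?E (c @ [hd c])" "set c \<inter> Z \<subseteq> U"
      "card U \<le> card (set c \<inter> Z) + 4 * s" by blast
    have c98: "98 * d \<le> card (set c \<inter> Z)" using c(4) cU s \<open>5 \<le> d\<close> by linarith
    have "card (set c \<inter> Z) \<le> card (set c)" by (intro card_mono) auto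
    also have "\<dots> = length c" using c(1) by (rule distinct_card)
    finally have "3 \<le> length c" using c98 \<open>5 \<le> d\<close> by linarith
    then obtain C where "graph_cycle H C" "cycle_verts C = set c"
      using graph_cycle_of_list[OF H(1) c(1) _ c(2)] by blast
    then show ?thesis using c(3) c98 by (intro exI[of _ C]) simp
  qed
  show ?thesis using Z cycles unfolding k_def by blast
qed

section \<open>Choice of the thresholds\<close>

theorem theorem1p5:
  fixes \<epsilon>\<^sub>1 L :: real
  assumes "0 < \<epsilon>\<^sub>1" and "\<epsilon>\<^sub>1 \<le> 1" and "1 \<le> L"
  shows "\<exists>d\<^sub>0 K\<^sub>0 :: real. \<forall>d K :: real. \<forall>n :: nat. \<forall>H :: 'a pair_pre_digraph.
    d\<^sub>0 \<le> d \<longrightarrow> K\<^sub>0 \<le> K \<longrightarrow>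
    (ln (real n)) ^ 100 \<le> d \<longrightarrow> d \<le> real n / K \<longrightarrow>
    pair_graph H \<longrightarrow> card (pverts H) = n \<longrightarrow>
    expander \<epsilon>\<^sub>1 (d / 30) H \<longrightarrow>
    d / 10 \<le> real (min_degree H) \<longrightarrow> real (max_degree H) \<le> L * d \<longrightarrow>
    (\<exists>Z \<subseteq> pverts H. card Z = nat \<lfloor>200 * d\<rfloor> \<and>
      (\<forall>U \<subseteq> Z. card U = nat \<lfloor>100 * d\<rfloor> \<longrightarrow>
        (\<exists>C. graph_cycle H C \<and> cycle_verts C \<inter> Z \<subseteq> U \<and>
             98 * d \<le> real (card (cycle_verts C \<inter> Z)))))"
proof -
  define c\<^sub>1 where "c\<^sub>1 = 3584000000 * L / \<epsilon>\<^sub>1\<^sup>2"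
  define c\<^sub>2 where "c\<^sub>2 = 2867200000000 * L\<^sup>2 / \<epsilon>\<^sub>1\<^sup>2"
  have c: "0 < c\<^sub>1" "0 < c\<^sub>2" unfolding c\<^sub>1_def c\<^sub>2_def using assms by auto
  \<comment> \<open>As \<open>ln n\<close> is at most \<open>d powr (1 / 100)\<close>, the left side
    bounds \<open>c\<^sub>1 * l ^ 5\<close> and has order \<open>d powr (1 / 20)\<close>.\<close>
  have "\<forall>\<^sub>F d in at_top. c\<^sub>1 * (ln 450 + d powr (1 / 100)) ^ 5 \<le> d" using c by real_asymp
  then obtain d\<^sub>0 where d0: "\<And>d. d\<^sub>0 \<le> d \<Longrightarrow> c\<^sub>1 * (ln 450 + d powr (1 / 100)) ^ 5 \<le> d"
    unfolding eventually_at_top_linorder by blast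
  \<comment> \<open>Here \<open>x\<close> stands for \<open>n / d\<close>, which is at least
    \<open>K\<close>.\<close>
  have "\<forall>\<^sub>F x in at_top. c\<^sub>2 * (ln (450 * x)) ^ 5 \<le> x" using c by real_asymp
  then obtain K\<^sub>0 where K0: "\<And>x. K\<^sub>0 \<le> x \<Longrightarrow> c\<^sub>2 * (ln (450 * x)) ^ 5 \<le> x"
    unfolding eventually_at_top_linorder by blast
  show ?thesis
  proof (rule exI[of _ "max 5 d\<^sub>0"], rule exI[of _ "max 400 K\<^sub>0"], intro allI impI)
    fix d K :: real and n :: nat and H :: "'a pair_pre_digraph"
    assume d: "max 5 d\<^sub>0 \<le> d" and K: "max 400 K\<^sub>0 \<le> K" and ln: "(ln (real n)) ^ 100 \<le> d"
      and dn: "d \<le> real n / K" and H: "pair_graph H" "card (pverts H) = n" "expander \<epsilon>\<^sub>1 (d / 30) H"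
      and min: "d / 10 \<le> real (min_degree H)" and max: "real (max_degree H) \<le> L * d"
    interpret pair_graph H by fact
    have Kd: "K * d \<le> n" using dn K by (simp add: field_simps)
    have Knd: "K \<le> n / d" using Kd d by (simp add: field_simps)
    have "400 * d \<le> K * d" using K d by (intro mult_right_mono) auto
    then have n400: "400 * d \<le> n" using Kd by linarith
    then have n1: "1 \<le> real n" using d by linarith
    let ?l = "ln (450 * real n / d)"
    have "ln (real n) \<le> d powr (1 / 100)"
    proof (rule ccontr)
      assume "\<not> ?thesis"
      then have "(d powr (1 / 100)) ^ 100 < ln (real n) ^ 100" by (intro power_strict_mono) auto
      moreover have "(d powr (1 / 100)) ^ 100 = d" using d by (simp add: powr_power)
      ultimately show False using ln by simp
    qed
    moreover have "?l \<le> ln (450 * real n)" using n1 d by (subst ln_le_cancel_iff) (auto simp: field_simps)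
    ultimately have "?l \<le> ln 450 + d powr (1 / 100)" using n1 by (simp add: ln_mult)
    moreover have l0: "0 \<le> ?l" using n400 d by (intro ln_ge_zero) (auto simp: field_simps)
    ultimately have "c\<^sub>1 * ?l ^ 5 \<le> c\<^sub>1 * (ln 450 + d powr (1 / 100)) ^ 5"
      using c by (intro mult_left_mono power_mono) auto
    then have l1: "c\<^sub>1 * ?l ^ 5 \<le> d" using d0[of d] d by auto
    have l2: "c\<^sub>2 * ?l ^ 5 \<le> n / d" using K0[of "n / d"] K Knd by auto
    have deg: "d / 10 \<le> out_degree (with_proj H) v" "out_degree (with_proj H) v \<le> L * d"
      if v: "v \<in> pverts H" for v
    proof -
      have "min_degree H \<le> out_degree (with_proj H) v"
        unfolding min_degree_def using v pair_finite_verts by (intro Min_le) auto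
      then show "d / 10 \<le> out_degree (with_proj H) v" using min by linarith
      have "out_degree (with_proj H) v \<le> max_degree H"
        unfolding max_degree_def using v pair_finite_verts by (intro Max_ge) auto
      then show "out_degree (with_proj H) v \<le> L * d" using max by linarith
    qed
    show "\<exists>Z \<subseteq> pverts H. card Z = nat \<lfloor>200 * d\<rfloor> \<and>
      (\<forall>U \<subseteq> Z. card U = nat \<lfloor>100 * d\<rfloor> \<longrightarrow>
        (\<exists>C. graph_cycle H C \<and> cycle_verts C \<inter> Z \<subseteq> U \<and>
             98 * d \<le> real (card (cycle_verts C \<inter> Z))))"
      by (rule robust_cycles[OF assms])
        (use d n400 l1 l2 H deg in \<open>auto simp: c\<^sub>1_def c\<^sub>2_def\<close>)
  qed
qed

end
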